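(* Let $f=h+\overline{g}$ be a locally univalent harmonic mapping in a simply connected domain $\Omega\subset\mathbb{C}$. Then $f$ is a harmonic Möbius transformation if and only if $S_f\equiv 0$ in $\Omega$.
   Context: A complex-valued harmonic function $f$ in a simply connected domain $\Omega$ is written $f=h+\overline{g}$ with $h,g$ analytic in $\Omega$. It is locally univalent iff its Jacobian $J_f=|h'|^2-|g'|^2$ does not vanish in $\Omega$; it is called sense-preserving if $J_f>0$ in $\Omega$ and sense-reversing if $J_f<0$ in $\Omega$ (then $\overline{f}$ is sense-preserving). For sense-preserving $f$, $h'\neq 0$ and the dilatation $\omega=g'/h'$ is analytic with $|\omega|<1$; its Schwarzian derivative is $$S_f=Sh+\frac{\overline{\omega}}{1-|\omega|^2}\left(\frac{h''}{h'}\,\omega'-\omega''\right)-\frac32\left(\frac{\omega'\,\overline{\omega}}{1-|\omega|^2}\right)^2,$$ where $Sh=(h''/h')'-\frac12(h''/h')^2$ is the classical Schwarzian derivative. For sense-reversing $f$, $S_f:=S_{\overline{f}}$. A locally univalent harmonic Möbius transformation is a locally univalent harmonic mapping of the form $f=\alpha T+\beta\overline{T}+\gamma$, where $T$ is a (classical, non-constant) Möbius transformation (analytic in $\Omega$) and $\alpha,\beta,\gamma\in\mathbb{C}$ are constants. *)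

theory Defs
  imports "HOL-Complex_Analysis.Complex_Analysis"
begin

definition harmonic_decomposition ::
    "complex set \<Rightarrow> (complex \<Rightarrow> complex) \<Rightarrow> (complex \<Rightarrow> complex) \<Rightarrow> (complex \<Rightarrow> complex) \<Rightarrow> bool" where
  "harmonic_decomposition \<Omega> f h g \<longleftrightarrow>
     h holomorphic_on \<Omega> \<and> g holomorphic_on \<Omega> \<and> (\<forall>z\<in>\<Omega>. f z = h z + cnj (g z))"

definition locally_univalent_on :: "complex set \<Rightarrow> (complex \<Rightarrow> complex) \<Rightarrow> bool" where
  "locally_univalent_on \<Omega> f \<longleftrightarrow> (\<forall>z\<in>\<Omega>. \<exists>U. open U \<and> z \<in> U \<and> U \<subseteq> \<Omega> \<and> inj_on f U)"

definition jacobian :: "(complex \<Rightarrow> complex) \<Rightarrow> (complex \<Rightarrow> complex) \<Rightarrow> complex \<Rightarrow> real" where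
  "jacobian h g z = (cmod (deriv h z))\<^sup>2 - (cmod (deriv g z))\<^sup>2"

definition sense_preserving_on ::
    "complex set \<Rightarrow> (complex \<Rightarrow> complex) \<Rightarrow> (complex \<Rightarrow> complex) \<Rightarrow> bool" where
  "sense_preserving_on \<Omega> h g \<longleftrightarrow> (\<forall>z\<in>\<Omega>. jacobian h g z > 0)"

definition classical_schwarzian :: "(complex \<Rightarrow> complex) \<Rightarrow> complex \<Rightarrow> complex" where
  "classical_schwarzian h z =
     deriv (\<lambda>w. deriv (deriv h) w / deriv h w) z - 1/2 * (deriv (deriv h) z / deriv h z)\<^sup>2"

definition dilatation :: "(complex \<Rightarrow> complex) \<Rightarrow> (complex \<Rightarrow> complex) \<Rightarrow> complex \<Rightarrow> complex" where
  "dilatation h g z = deriv g z / deriv h z"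

definition schwarzian_sense_preserving ::
    "(complex \<Rightarrow> complex) \<Rightarrow> (complex \<Rightarrow> complex) \<Rightarrow> complex \<Rightarrow> complex" where
  "schwarzian_sense_preserving h g z =
     (let \<omega> = dilatation h g; d = 1 - complex_of_real ((cmod (\<omega> z))\<^sup>2) in
       classical_schwarzian h z
       + cnj (\<omega> z) / d * (deriv (deriv h) z / deriv h z * deriv \<omega> z - deriv (deriv \<omega>) z)
       - 3/2 * (deriv \<omega> z * cnj (\<omega> z) / d)\<^sup>2)"

(* If f = h + cnj g is sense-reversing, then cnj f = g + cnj h, so S_f := S_(cnj f) exchanges
   h and g. The second branch is meant only for that case: on a connected \<Omega> a locally
   univalent f is either sense-preserving or sense-reversing. The value depends on f alone,
   since h and g enter only through their derivatives. *)
definition harmonic_schwarzian ::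
    "complex set \<Rightarrow> (complex \<Rightarrow> complex) \<Rightarrow> (complex \<Rightarrow> complex) \<Rightarrow> complex \<Rightarrow> complex" where
  "harmonic_schwarzian \<Omega> h g z =
     (if sense_preserving_on \<Omega> h g then schwarzian_sense_preserving h g z
      else schwarzian_sense_preserving g h z)"

(* The condition c * z + d \<noteq> 0 keeps the pole outside \<Omega>, i.e. T is analytic there. *)
definition moebius_on :: "complex set \<Rightarrow> (complex \<Rightarrow> complex) \<Rightarrow> bool" where
  "moebius_on \<Omega> T \<longleftrightarrow>
     (\<exists>a b c d. a * d - b * c \<noteq> 0 \<and>
        (\<forall>z\<in>\<Omega>. c * z + d \<noteq> 0 \<and> T z = (a * z + b) / (c * z + d)))"

(* Harmonicity follows from the form: \<beta> * cnj T = cnj (cnj \<beta> * T). *)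
definition harmonic_moebius_on :: "complex set \<Rightarrow> (complex \<Rightarrow> complex) \<Rightarrow> bool" where
  "harmonic_moebius_on \<Omega> f \<longleftrightarrow>
     locally_univalent_on \<Omega> f \<and>
     (\<exists>T \<alpha> \<beta> \<gamma>. moebius_on \<Omega> T \<and> (\<forall>z\<in>\<Omega>. f z = \<alpha> * T z + \<beta> * cnj (T z) + \<gamma>))"

end

theory Submission
  imports Defs
begin

text \<open>
  The difficult direction rests on one observation. Where \<open>H' \<noteq> 0\<close> and \<open>\<bar>\<omega>\<bar> \<noteq> 1\<close>, multiplying
  \<open>S\<^sub>f = 0\<close> by \<open>(1 - \<bar>\<omega>\<bar>\<^sup>2)\<^sup>2\<close> gives a polynomial of degree two in the conjugate of \<open>\<omega>\<close> whose
  coefficients are analytic. If \<open>\<omega>' \<noteq> 0\<close>, differentiating twice with respect to the conjugate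
  variable kills all three coefficients (\<open>conj_quadratic_eq_0\<close>). The first is \<open>SH\<close>, the second is
  then \<open>(H''/H') \<omega>' - \<omega>''\<close>, and what is left of the third is a multiple of \<open>\<omega>'\<^sup>2\<close>: a contradiction.
  Hence \<open>\<omega>\<close> is locally a constant \<open>c\<close>, the equation collapses to \<open>SH = 0\<close>, and classically \<open>H'\<close> is
  the inverse square of an affine function. Both \<open>(a z + b)\<^sup>2 H' = 1\<close> and \<open>G' = c H'\<close> extend to the
  whole domain by the identity theorem; the first makes \<open>H\<close> a Moebius transformation without pole
  there, the second makes \<open>f\<close> a combination of \<open>H\<close> and its conjugate
  (\<open>schwarzian_zero_imp_moebius\<close>).

  This argument starts from a single point with \<open>H' \<noteq> 0\<close> and nonzero Jacobian of either sign.
  So it applies to \<open>(H, G) = (h, g)\<close> and to \<open>(H, G) = (g, h)\<close> alike,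
  and it replaces Lewy's theorem on the nonvanishing of the Jacobian by the weaker fact that the
  Jacobian of a locally univalent map is not identically zero. That fact holds because otherwise
  \<open>f\<close> would locally have the form \<open>\<alpha> T + \<beta> cnj T + \<gamma>\<close> with \<open>\<bar>\<alpha>\<bar> = \<bar>\<beta>\<bar>\<close>, and such a map sends
  open sets into a line (\<open>unimodular_combination_not_inj\<close>).

  Conversely, for \<open>f = \<alpha> T + \<beta> cnj T + \<gamma>\<close> uniqueness of the analytic and antianalytic parts gives
  \<open>h' = \<alpha> T'\<close> and \<open>g' = cnj \<beta> T'\<close>, so the dilatation is constant and \<open>S\<^sub>f\<close> reduces to the classical
  Schwarzian of a Moebius transformation. Local univalence forces \<open>\<bar>\<alpha>\<bar> \<noteq> \<bar>\<beta>\<bar>\<close>, which ensures that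
  the function playing the role of \<open>H\<close> is not constant.
\<close>

section \<open>Uniqueness of conjugate-analytic expansions\<close>

text \<open>
  The numbers \<open>A\<close> and \<open>B\<close> are the two Wirtinger derivatives of \<open>F\<close> at \<open>z\<close>. The directions \<open>1\<close> and
  \<open>\<i>\<close> separate them.
\<close>
lemma has_derivative_conj_linear_eq_0:
  fixes F :: "complex \<Rightarrow> complex"
  assumes "open S" "z \<in> S" "\<And>w. w \<in> S \<Longrightarrow> F w = 0"
    and "(F has_derivative (\<lambda>v. A * v + B * cnj v)) (at z)"
  shows "A = 0" "B = 0"
proof -
  have "((\<lambda>_. 0) has_derivative (\<lambda>v. A * v + B * cnj v)) (at z)"
    by (rule has_derivative_transform_within_open[OF assms(4,1,2)]) (use assms(3) in auto)
  from has_derivative_unique[OF this has_derivative_const]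
  have eq: "A * v + B * cnj v = 0" for v by meson
  have "A + B = 0" "A - B = 0"
    using eq[of 1] eq[of \<i>] by (auto simp: algebra_simps)
  then show "A = 0" "B = 0"
    by auto
qed

text \<open>
  The derivative of the relation with respect to the conjugate variable is \<open>q cnj(\<omega>') = 0\<close>.
\<close>
lemma conj_affine_eq_0:
  fixes p q \<omega> :: "complex \<Rightarrow> complex"
  assumes "open S" "p holomorphic_on S" "q holomorphic_on S" "\<omega> holomorphic_on S"
    and \<omega>': "\<And>w. w \<in> S \<Longrightarrow> deriv \<omega> w \<noteq> 0"
    and eq: "\<And>w. w \<in> S \<Longrightarrow> p w + q w * cnj (\<omega> w) = 0" and "z \<in> S"
  shows "p z = 0" "q z = 0"
proof -
  have d: "(p has_field_derivative deriv p z) (at z)" "(q has_field_derivative deriv q z) (at z)"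
     "(\<omega> has_field_derivative deriv \<omega> z) (at z)"
    using assms by (auto intro: holomorphic_derivI)
  have "((\<lambda>w. p w + q w * cnj (\<omega> w)) has_derivative
      (\<lambda>v. (deriv p z + deriv q z * cnj (\<omega> z)) * v + (q z * cnj (deriv \<omega> z)) * cnj v)) (at z)"
    by (rule derivative_eq_intros d[THEN has_field_derivative_imp_has_derivative] refl)+
       (simp add: algebra_simps)
  from has_derivative_conj_linear_eq_0(2)[OF \<open>open S\<close> \<open>z \<in> S\<close> _ this] eq
  have "q z * cnj (deriv \<omega> z) = 0" by blast
  then show "q z = 0" using \<omega>' \<open>z \<in> S\<close> by auto
  then show "p z = 0" using eq \<open>z \<in> S\<close> by force
qed

text \<open>
  Differentiating with respect to the conjugate variable lowers the degree in \<open>cnj \<omega>\<close> by one and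
  keeps the coefficients analytic, which leads back to the affine case.
\<close>
lemma conj_quadratic_eq_0:
  fixes a0 a1 a2 \<omega> :: "complex \<Rightarrow> complex"
  assumes "open S" "a0 holomorphic_on S" "a1 holomorphic_on S" "a2 holomorphic_on S"
    and \<omega>: "\<omega> holomorphic_on S" and \<omega>': "\<And>w. w \<in> S \<Longrightarrow> deriv \<omega> w \<noteq> 0"
    and eq: "\<And>w. w \<in> S \<Longrightarrow> a0 w + a1 w * cnj (\<omega> w) + a2 w * (cnj (\<omega> w))\<^sup>2 = 0" and "z \<in> S"
  shows "a0 z = 0" "a1 z = 0" "a2 z = 0"
proof -
  have "a1 x + (2 * a2 x) * cnj (\<omega> x) = 0" if "x \<in> S" for x
  proof -
    have d: "(a0 has_field_derivative deriv a0 x) (at x)" "(a1 has_field_derivative deriv a1 x) (at x)"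
       "(a2 has_field_derivative deriv a2 x) (at x)" "(\<omega> has_field_derivative deriv \<omega> x) (at x)"
      using assms that by (auto intro: holomorphic_derivI)
    have "((\<lambda>w. a0 w + a1 w * cnj (\<omega> w) + a2 w * (cnj (\<omega> w) * cnj (\<omega> w))) has_derivative
        (\<lambda>v. (deriv a0 x + deriv a1 x * cnj (\<omega> x) + deriv a2 x * (cnj (\<omega> x))\<^sup>2) * v
           + ((a1 x + 2 * a2 x * cnj (\<omega> x)) * cnj (deriv \<omega> x)) * cnj v)) (at x)"
      by (rule derivative_eq_intros d[THEN has_field_derivative_imp_has_derivative] refl)+
         (simp add: algebra_simps power2_eq_square)
    from has_derivative_conj_linear_eq_0(2)[OF \<open>open S\<close> that _ this] eq
    show ?thesis
      using \<omega>'[OF that] by (auto simp: power2_eq_square)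
  qed
  moreover have "(\<lambda>w. 2 * a2 w) holomorphic_on S"
    using assms by (intro holomorphic_intros)
  ultimately have "a1 z = 0" "2 * a2 z = 0"
    using conj_affine_eq_0[OF \<open>open S\<close> \<open>a1 holomorphic_on S\<close> _ \<omega> \<omega>', of "\<lambda>w. 2 * a2 w" z] \<open>z \<in> S\<close>
    by blast+
  then show "a1 z = 0" "a2 z = 0" by auto
  then show "a0 z = 0" using eq[OF \<open>z \<in> S\<close>] by auto
qed

section \<open>Vanishing Schwarzian derivatives\<close>

lemma dilatation_holomorphic_on:
  assumes "open S" "H holomorphic_on S" "G holomorphic_on S" "\<And>z. z \<in> S \<Longrightarrow> deriv H z \<noteq> 0"
  shows "dilatation H G holomorphic_on S"
  unfolding dilatation_def using assms by (intro holomorphic_intros) auto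

text \<open>
  Near a point with \<open>\<omega>' \<noteq> 0\<close>, the equation with its denominators cleared would be a polynomial
  relation for \<open>cnj \<omega>\<close> with analytic coefficients. The hypothesis \<open>\<bar>\<omega>\<bar> \<noteq> 1\<close>, in place of
  \<open>\<bar>\<omega>\<bar> < 1\<close>, makes the lemma usable before the orientation is known.
\<close>
lemma schwarzian_zero_imp_deriv_dilatation_eq_0:
  assumes "open S" and H: "H holomorphic_on S" and G: "G holomorphic_on S"
    and H': "\<And>z. z \<in> S \<Longrightarrow> deriv H z \<noteq> 0"
    and J: "\<And>z. z \<in> S \<Longrightarrow> cmod (deriv H z) \<noteq> cmod (deriv G z)"
    and S0: "\<And>z. z \<in> S \<Longrightarrow> schwarzian_sense_preserving H G z = 0"
    and "z \<in> S"
  shows "deriv (dilatation H G) z = 0"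
proof (rule ccontr)
  assume nz: "deriv (dilatation H G) z \<noteq> 0"
  define \<omega> where "\<omega> = dilatation H G"
  define P where "P = (\<lambda>z. deriv (deriv H) z / deriv H z)"
  define \<sigma> where "\<sigma> = classical_schwarzian H"
  define A where "A = (\<lambda>z. P z * deriv \<omega> z - deriv (deriv \<omega>) z)"
  define U where "U = S \<inter> (deriv \<omega> -` (- {0}))"
  note hol = holomorphic_deriv[OF _ \<open>open S\<close>]
  have \<omega>: "\<omega> holomorphic_on S"
    unfolding \<omega>_def by (rule dilatation_holomorphic_on) (use assms in auto)
  have P: "P holomorphic_on S"
    unfolding P_def by (intro holomorphic_intros hol H H')
  have \<sigma>: "\<sigma> holomorphic_on S"
  proof -
    have "\<sigma> = (\<lambda>z. deriv P z - 1/2 * (P z)\<^sup>2)"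
      by (simp add: \<sigma>_def classical_schwarzian_def fun_eq_iff P_def)
    then show ?thesis
      using hol[OF P] P by (auto intro!: holomorphic_intros)
  qed
  have A: "A holomorphic_on S"
    unfolding A_def by (intro holomorphic_intros hol P \<omega>)
  have "open U"
    unfolding U_def
    by (intro continuous_open_preimage holomorphic_on_imp_continuous_on hol \<omega> \<open>open S\<close>) auto
  have "U \<subseteq> S" by (auto simp: U_def)
  have "z \<in> U" using nz \<open>z \<in> S\<close> by (auto simp: U_def \<omega>_def)
  \<comment> \<open>The expansion of \<open>\<sigma> (1 - \<omega> cnj \<omega>)\<^sup>2 + A cnj \<omega> (1 - \<omega> cnj \<omega>) - 3/2 (\<omega>' cnj \<omega>)\<^sup>2\<close>
    in powers of \<open>cnj \<omega>\<close>.\<close>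
  have eq: "\<sigma> w + (A w - 2 * \<omega> w * \<sigma> w) * cnj (\<omega> w)
        + ((\<omega> w)\<^sup>2 * \<sigma> w - \<omega> w * A w - 3/2 * (deriv \<omega> w)\<^sup>2) * (cnj (\<omega> w))\<^sup>2 = 0" if "w \<in> S" for w
  proof -
    define d where "d = 1 - \<omega> w * cnj (\<omega> w)"
    have "cmod (\<omega> w) \<noteq> 1"
      using J[OF that] H'[OF that] by (auto simp: \<omega>_def dilatation_def norm_divide field_simps)
    then have "complex_of_real ((cmod (\<omega> w))\<^sup>2) \<noteq> 1"
      by (metis norm_ge_zero of_real_eq_1_iff power2_eq_1_iff norm_one norm_minus_cancel
          abs_norm_cancel real_sqrt_abs real_sqrt_one)
    then have d: "d \<noteq> 0" "1 - complex_of_real ((cmod (\<omega> w))\<^sup>2) = d"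
      using complex_norm_square[of "\<omega> w"] by (auto simp: d_def)
    have "\<sigma> w + cnj (\<omega> w) / d * A w - 3/2 * (deriv \<omega> w * cnj (\<omega> w) / d)\<^sup>2 = 0"
      using S0[OF that] d(2)
      by (simp add: schwarzian_sense_preserving_def Let_def \<omega>_def[symmetric] \<sigma>_def[symmetric] A_def P_def)
    moreover have "\<sigma> w * d\<^sup>2 + cnj (\<omega> w) * d * A w - 3/2 * (deriv \<omega> w * cnj (\<omega> w))\<^sup>2
        = (\<sigma> w + cnj (\<omega> w) / d * A w - 3/2 * (deriv \<omega> w * cnj (\<omega> w) / d)\<^sup>2) * d\<^sup>2"
      using d(1) by (simp add: divide_simps power2_eq_square) (simp add: algebra_simps)
    ultimately have "\<sigma> w * d\<^sup>2 + cnj (\<omega> w) * d * A w - 3/2 * (deriv \<omega> w * cnj (\<omega> w))\<^sup>2 = 0"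
      by (simp only: mult_zero_left)
    then show ?thesis
      by (simp add: d_def algebra_simps power2_eq_square)
  qed
  have hols: "\<sigma> holomorphic_on U" "(\<lambda>w. A w - 2 * \<omega> w * \<sigma> w) holomorphic_on U"
     "(\<lambda>w. (\<omega> w)\<^sup>2 * \<sigma> w - \<omega> w * A w - 3/2 * (deriv \<omega> w)\<^sup>2) holomorphic_on U"
    by (rule holomorphic_on_subset[OF _ \<open>U \<subseteq> S\<close>], intro holomorphic_intros hol \<omega> A \<sigma>)+
  have "deriv \<omega> w \<noteq> 0" if "w \<in> U" for w using that by (auto simp: U_def)
  note * = conj_quadratic_eq_0[OF \<open>open U\<close> hols holomorphic_on_subset[OF \<omega> \<open>U \<subseteq> S\<close>] this _ \<open>z \<in> U\<close>]
  have "\<sigma> z = 0" "A z - 2 * \<omega> z * \<sigma> z = 0"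
      "(\<omega> z)\<^sup>2 * \<sigma> z - \<omega> z * A z - 3/2 * (deriv \<omega> z)\<^sup>2 = 0"
    using *[OF _ eq] \<open>U \<subseteq> S\<close> by blast+
  then show False
    using nz by (simp add: \<omega>_def)
qed

lemma deriv_eq_imp_add_const:
  fixes P Q :: "complex \<Rightarrow> complex"
  assumes "open S" "connected S" "P holomorphic_on S" "Q holomorphic_on S"
    and "\<And>z. z \<in> S \<Longrightarrow> deriv P z = deriv Q z"
  obtains C where "\<And>z. z \<in> S \<Longrightarrow> P z = Q z + C"
proof -
  have "((\<lambda>z. P z - Q z) has_field_derivative 0) (at z)" if "z \<in> S" for z
    using DERIV_diff[OF holomorphic_derivI[OF assms(3,1) that] holomorphic_derivI[OF assms(4,1) that]]
      assms(5)[OF that] by simp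
  from has_field_derivative_0_imp_constant_on[OF this assms(2,1)]
  obtain C where "\<And>z. z \<in> S \<Longrightarrow> P z - Q z = C" by (auto simp: constant_on_def)
  then show ?thesis by (intro that[of C]) (auto simp: algebra_simps)
qed

text \<open>
  The function \<open>v = (H')\<^bsup>-1/2\<^esup>\<close> solves the linear equation \<open>v'' + (SH/2) v = 0\<close>. So \<open>SH = 0\<close>
  makes \<open>v\<close> affine. On a ball the square root has an analytic branch.
\<close>
lemma classical_schwarzian_zero_imp_deriv:
  assumes H: "H holomorphic_on ball z0 r"
    and H': "\<And>z. z \<in> ball z0 r \<Longrightarrow> deriv H z \<noteq> 0"
    and S0: "\<And>z. z \<in> ball z0 r \<Longrightarrow> classical_schwarzian H z = 0"
  obtains a b where "\<And>z. z \<in> ball z0 r \<Longrightarrow> (a * z + b)\<^sup>2 * deriv H z = 1"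
proof -
  let ?B = "ball z0 r"
  have oB: "open ?B" "connected ?B" by auto
  define P where "P = (\<lambda>z. deriv (deriv H) z / deriv H z)"
  note hol = holomorphic_deriv[OF _ \<open>open ?B\<close>]
  have P: "P holomorphic_on ?B"
    unfolding P_def by (intro holomorphic_intros hol H H')
  have P': "deriv P z = (P z)\<^sup>2 / 2" if "z \<in> ?B" for z
    using S0[OF that] by (simp add: classical_schwarzian_def P_def)
  obtain s where s: "s holomorphic_on ?B" "\<And>z. z \<in> ?B \<Longrightarrow> deriv H z = (s z)\<^sup>2"
    using contractible_imp_holomorphic_sqrt[OF hol[OF H] convex_imp_contractible[OF convex_ball] H']
    by blast
  have snz: "s z \<noteq> 0" if "z \<in> ?B" for z using H'[OF that] s(2)[OF that] by auto
  define v where "v = (\<lambda>z. 1 / s z)"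
  have v: "v holomorphic_on ?B"
    unfolding v_def using s(1) snz by (intro holomorphic_intros) auto
  have vH: "deriv (deriv H) z = 2 * s z * deriv s z" if "z \<in> ?B" for z
  proof -
    have "deriv (deriv H) z = deriv (\<lambda>z. (s z)\<^sup>2) z"
      by (rule complex_derivative_transform_within_open[OF hol[OF H] _ oB(1) that s(2)])
         (auto intro!: holomorphic_intros s(1))
    also have "\<dots> = 2 * s z * deriv s z"
      by (rule DERIV_imp_deriv) (auto intro!: derivative_eq_intros holomorphic_derivI[OF s(1) oB(1) that])
    finally show ?thesis .
  qed
  have v': "deriv v z = - (P z * v z / 2)" if "z \<in> ?B" for z
  proof -
    have "deriv v z = - deriv s z / (s z)\<^sup>2"
      unfolding v_def
      by (rule DERIV_imp_deriv)
        (use snz[OF that] in \<open>auto intro!: derivative_eq_intros holomorphic_derivI[OF s(1) oB(1) that]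
            simp: power2_eq_square\<close>)
    then show ?thesis
      using snz[OF that] by (simp add: P_def vH[OF that] s(2)[OF that] v_def field_simps power2_eq_square)
  qed
  have v'': "deriv (deriv v) z = 0" if "z \<in> ?B" for z
  proof -
    have "deriv (deriv v) z = deriv (\<lambda>z. - (P z * v z / 2)) z"
      by (rule complex_derivative_transform_within_open[OF hol[OF v] _ oB(1) that v'])
         (auto intro!: holomorphic_intros P v)
    also have "\<dots> = - (P z * deriv v z + deriv P z * v z) / 2"
      by (rule DERIV_imp_deriv) (auto intro!: derivative_eq_intros holomorphic_derivI[OF v oB(1) that]
           holomorphic_derivI[OF P oB(1) that] simp: field_simps)
    also have "\<dots> = 0"
      by (simp add: v'[OF that] P'[OF that] power2_eq_square)
    finally show ?thesis .
  qed
  obtain a where a: "\<And>z. z \<in> ?B \<Longrightarrow> deriv v z = a"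
    using deriv_eq_imp_add_const[OF oB hol[OF v], of "\<lambda>_. 0"] v'' by auto
  obtain b where b: "\<And>z. z \<in> ?B \<Longrightarrow> v z = a * z + b"
    using deriv_eq_imp_add_const[OF oB v, of "\<lambda>z. a * z"] a
    by (auto intro!: holomorphic_intros)
  show ?thesis
  proof (rule that)
    fix z assume "z \<in> ?B"
    with b snz s(2) show "(a * z + b)\<^sup>2 * deriv H z = 1"
      by (auto simp: v_def power_divide simp flip: b)
  qed
qed

text \<open>
  The relation itself keeps the zero of \<open>a z + b\<close> out of the domain.
\<close>
lemma moebius_on_if_deriv_inverse_square:
  assumes "open \<Omega>" "connected \<Omega>" "z0 \<in> \<Omega>" and H: "H holomorphic_on \<Omega>"
    and eq: "\<And>z. z \<in> \<Omega> \<Longrightarrow> (a * z + b)\<^sup>2 * deriv H z = 1"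
  shows "moebius_on \<Omega> H"
proof -
  define p where "p = a * z0 + b"
  \<comment> \<open>The antiderivative of \<open>(a z + b)\<^bsup>-2\<^esup>\<close> that vanishes at \<open>z0\<close>; unlike \<open>-1 / (a (a z + b))\<close> it
    covers the affine case \<open>a = 0\<close> as well.\<close>
  define T where "T = (\<lambda>z. (z - z0) / (p * (a * z + b)))"
  have nz: "a * z + b \<noteq> 0" if "z \<in> \<Omega>" for z using eq[OF that] by auto
  have p: "p \<noteq> 0" using nz assms by (auto simp: p_def)
  have T: "T holomorphic_on \<Omega>"
    unfolding T_def using nz p by (intro holomorphic_intros) auto
  have "deriv T z = deriv H z" if "z \<in> \<Omega>" for z
  proof -
    have "deriv T z = (p * (a * z + b) - (z - z0) * (p * a)) / (p * (a * z + b))\<^sup>2"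
      unfolding T_def
      by (rule DERIV_imp_deriv)
         (use nz[OF that] p in \<open>auto intro!: derivative_eq_intros simp: power2_eq_square\<close>)
    also have "p * (a * z + b) - (z - z0) * (p * a) = p\<^sup>2"
      by (simp add: p_def algebra_simps power2_eq_square)
    also have "p\<^sup>2 / (p * (a * z + b))\<^sup>2 = deriv H z"
    proof -
      have "deriv H z = 1 / (a * z + b)\<^sup>2"
        using nz[OF that] eq[OF that] by (simp add: eq_divide_eq mult.commute)
      then show ?thesis
        using p by (simp add: power_mult_distrib)
    qed
    finally show ?thesis .
  qed
  then obtain C where C: "\<And>z. z \<in> \<Omega> \<Longrightarrow> H z = T z + C"
    using deriv_eq_imp_add_const[OF assms(1,2) H T] by metis
  show ?thesis
    unfolding moebius_on_def
  proof (intro exI conjI ballI)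
    have "(C * p * a + 1) * (p * b) - (C * p * b - z0) * (p * a) = p\<^sup>2"
      by (simp add: p_def algebra_simps power2_eq_square)
    then show "(C * p * a + 1) * (p * b) - (C * p * b - z0) * (p * a) \<noteq> 0"
      using p by simp
    fix z assume z: "z \<in> \<Omega>"
    have *: "p * a * z + p * b = p * (a * z + b)" by (simp add: algebra_simps)
    show "p * a * z + p * b \<noteq> 0" using nz[OF z] p unfolding * by auto
    show "H z = ((C * p * a + 1) * z + (C * p * b - z0)) / (p * a * z + p * b)"
      unfolding * C[OF z] T_def using nz[OF z] p by (simp add: divide_simps) (simp add: algebra_simps)
  qed
qed

text \<open>
  One good point \<open>z0\<close> suffices: the local conclusions, a constant dilatation and \<open>SH = 0\<close>, become
  polynomial identities for \<open>H'\<close> and \<open>G'\<close>, and these spread over the connected domain even across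
  possible zeros of the Jacobian.
\<close>
lemma schwarzian_zero_imp_moebius:
  assumes "open \<Omega>" "connected \<Omega>" and H: "H holomorphic_on \<Omega>" and G: "G holomorphic_on \<Omega>"
    and "z0 \<in> \<Omega>" "deriv H z0 \<noteq> 0" "cmod (deriv H z0) \<noteq> cmod (deriv G z0)"
    and S0: "\<And>z. z \<in> \<Omega> \<Longrightarrow> schwarzian_sense_preserving H G z = 0"
  obtains c C where "moebius_on \<Omega> H" "\<And>z. z \<in> \<Omega> \<Longrightarrow> G z = c * H z + C"
proof -
  note hol = holomorphic_deriv[OF _ \<open>open \<Omega>\<close>]
  let ?D = "(\<Omega> \<inter> deriv H -` (- {0})) \<inter> (\<Omega> \<inter> (\<lambda>z. cmod (deriv H z) - cmod (deriv G z)) -` (- {0}))"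
  have "continuous_on \<Omega> (deriv H)" "continuous_on \<Omega> (deriv G)"
    using hol[OF H] hol[OF G] by (auto intro: holomorphic_on_imp_continuous_on)
  then have "open ?D"
    using \<open>open \<Omega>\<close> by (intro open_Int continuous_open_preimage continuous_on_diff continuous_on_norm) auto
  moreover have "z0 \<in> ?D" using assms by auto
  ultimately obtain r where r: "r > 0" "ball z0 r \<subseteq> ?D"
    using open_contains_ball by blast
  let ?B = "ball z0 r"
  have B: "?B \<subseteq> \<Omega>" using r by auto
  have oB: "open ?B" "connected ?B" "?B \<noteq> {}" using r by auto
  have H': "deriv H z \<noteq> 0" and J: "cmod (deriv H z) \<noteq> cmod (deriv G z)" if "z \<in> ?B" for z
    using that r by auto
  note HB = holomorphic_on_subset[OF H B] and GB = holomorphic_on_subset[OF G B]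
  have \<omega>0: "deriv (dilatation H G) z = 0" if "z \<in> ?B" for z
    by (rule schwarzian_zero_imp_deriv_dilatation_eq_0[OF oB(1) HB GB H' J _ that]) (use S0 B in auto)
  obtain c where c: "\<And>z. z \<in> ?B \<Longrightarrow> dilatation H G z = c"
    using deriv_eq_imp_add_const[OF oB(1,2) dilatation_holomorphic_on[OF oB(1) HB GB H'], of "\<lambda>_. 0"] \<omega>0
    by auto
  have "deriv (deriv (dilatation H G)) z = 0" if "z \<in> ?B" for z
  proof -
    have "deriv (deriv (dilatation H G)) z = deriv (\<lambda>_. 0) z"
      by (rule complex_derivative_transform_within_open[OF _ _ oB(1) that])
         (use \<omega>0 in \<open>auto intro!: holomorphic_intros dilatation_holomorphic_on HB GB H'\<close>)
    then show ?thesis by simp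
  qed
  then have "classical_schwarzian H z = 0" if "z \<in> ?B" for z
    using S0[of z] B that \<omega>0[OF that] by (auto simp: schwarzian_sense_preserving_def)
  from classical_schwarzian_zero_imp_deriv[OF HB H' this]
  obtain a b where ab: "\<And>z. z \<in> ?B \<Longrightarrow> (a * z + b)\<^sup>2 * deriv H z = 1" by blast
  have "(a * z + b)\<^sup>2 * deriv H z = 1" if "z \<in> \<Omega>" for z
    by (rule analytic_continuation_open[OF oB(1) assms(1) oB(3) assms(2) B _ _ ab that])
       (intro holomorphic_intros hol H)+
  then have M: "moebius_on \<Omega> H"
    using moebius_on_if_deriv_inverse_square[OF assms(1,2,5) H] by blast
  have "deriv G z = c * deriv H z" if "z \<in> \<Omega>" for z
  proof (rule analytic_continuation_open[OF oB(1) assms(1) oB(3) assms(2) B _ _ _ that])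
    show "deriv G z = c * deriv H z" if "z \<in> ?B" for z
      using c[OF that] H'[OF that] by (auto simp: dilatation_def)
  qed (intro holomorphic_intros hol H G)+
  then have "deriv G z = deriv (\<lambda>z. c * H z) z" if "z \<in> \<Omega>" for z
    using that deriv_cmult[OF holomorphic_on_imp_differentiable_at[OF H assms(1) that]] by simp
  moreover have "(\<lambda>z. c * H z) holomorphic_on \<Omega>"
    by (intro holomorphic_intros H)
  ultimately obtain C where "\<And>z. z \<in> \<Omega> \<Longrightarrow> G z = c * H z + C"
    using deriv_eq_imp_add_const[OF assms(1,2) G] by blast
  with M show ?thesis by (rule that)
qed

section \<open>Degenerate combinations are not locally univalent\<close>

text \<open>
  The real-linear map \<open>w \<mapsto> \<alpha> w + \<beta> cnj w\<close> is singular when \<open>\<bar>\<alpha>\<bar> = \<bar>\<beta>\<bar>\<close>. By the open mapping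
  theorem, \<open>T\<close> takes two values that differ by a vector of its kernel.
\<close>
lemma unimodular_combination_not_inj:
  assumes "open U" "U \<noteq> {}" and T: "T holomorphic_on U" and "cmod \<alpha> = cmod \<beta>"
  shows "\<not> inj_on (\<lambda>z. \<alpha> * T z + \<beta> * cnj (T z) + \<gamma>) U"
proof
  assume inj: "inj_on (\<lambda>z. \<alpha> * T z + \<beta> * cnj (T z) + \<gamma>) U"
  obtain z0 r where r: "r > 0" "ball z0 r \<subseteq> U"
    using assms open_contains_ball by (metis ex_in_conv)
  obtain v where v: "v \<noteq> 0" "\<alpha> * v + \<beta> * cnj v = 0"
  proof (cases "\<beta> = 0")
    case True
    with that[of 1] assms show ?thesis by auto
  next
    case False
    \<comment> \<open>The kernel condition \<open>v / cnj v = -\<beta> / \<alpha>\<close> is solved by a square root of the right-hand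
      side, because a unimodular \<open>v\<close> satisfies \<open>v / cnj v = v\<^sup>2\<close>.\<close>
    define u where "u = csqrt (- \<beta> / \<alpha>)"
    have "\<alpha> \<noteq> 0" using False assms by auto
    have u2: "u\<^sup>2 = - \<beta> / \<alpha>" by (simp add: u_def)
    then have "(cmod u)\<^sup>2 = 1" using False assms
      by (metis \<open>\<alpha> \<noteq> 0\<close> divide_self norm_divide norm_eq_zero norm_minus_cancel norm_power)
    then have "u * cnj u = 1" by (simp add: complex_norm_square[symmetric])
    moreover have "\<alpha> * u + \<beta> * cnj u = (\<alpha> * u\<^sup>2 + \<beta> * (u * cnj u)) * cnj u"
      using \<open>u * cnj u = 1\<close> by (simp add: algebra_simps power2_eq_square)
    ultimately have "\<alpha> * u + \<beta> * cnj u = 0" using u2 \<open>\<alpha> \<noteq> 0\<close> by simp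
    moreover have "u \<noteq> 0" using \<open>u * cnj u = 1\<close> by auto
    ultimately show ?thesis by (rule that[rotated])
  qed
  have TB: "T holomorphic_on ball z0 r" using T r holomorphic_on_subset by blast
  have "inj_on T U"
    using inj by (auto simp: inj_on_def)
  then have "\<not> T constant_on ball z0 r"
  proof -
    have "z0 \<in> ball z0 r" "z0 + of_real (r/2) \<in> ball z0 r" "z0 + of_real (r/2) \<noteq> z0"
      using r by (auto simp: dist_norm)
    then show ?thesis
      using \<open>inj_on T U\<close> r(2) unfolding constant_on_def inj_on_def by (metis subsetD)
  qed
  then have "open (T ` ball z0 r)"
    using open_mapping_thm[OF TB open_ball connected_ball open_ball] by blast
  moreover have "T z0 \<in> T ` ball z0 r" using r by auto
  ultimately obtain e where e: "e > 0" "ball (T z0) e \<subseteq> T ` ball z0 r"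
    using open_contains_ball by meson
  define t where "t = e / (2 * cmod v)"
  have "t > 0" using e v by (simp add: t_def)
  have "T z0 + of_real t * v \<in> ball (T z0) e"
    using e v by (simp add: dist_norm t_def norm_mult norm_divide)
  then obtain z1 where z1: "z1 \<in> ball z0 r" "T z1 = T z0 + of_real t * v"
    using e(2) by (metis image_iff subsetD)
  have "\<alpha> * T z1 + \<beta> * cnj (T z1) + \<gamma>
      = \<alpha> * T z0 + \<beta> * cnj (T z0) + \<gamma> + of_real t * (\<alpha> * v + \<beta> * cnj v)"
    by (simp add: z1(2) algebra_simps)
  then have "\<alpha> * T z1 + \<beta> * cnj (T z1) + \<gamma> = \<alpha> * T z0 + \<beta> * cnj (T z0) + \<gamma>"
    using v by simp
  moreover have "z1 \<in> U" "z0 \<in> U" using z1(1) r by auto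
  ultimately have "z1 = z0" using inj by (auto simp: inj_on_def)
  with z1 v \<open>t > 0\<close> show False by auto
qed

text \<open>
  If \<open>\<bar>h'\<bar> = \<bar>g'\<bar>\<close> everywhere, then on some ball \<open>g' = c h'\<close> with \<open>\<bar>c\<bar> = 1\<close>: by the maximum
  principle applied to \<open>g'/h'\<close>, or trivially if \<open>h'\<close> vanishes identically. There \<open>f\<close> is a
  combination of \<open>h\<close> and \<open>cnj h\<close> with coefficients of equal modulus.
\<close>
lemma locally_univalent_imp_ex_jacobian_nonzero:
  assumes "open \<Omega>" "\<Omega> \<noteq> {}" and "harmonic_decomposition \<Omega> f h g" "locally_univalent_on \<Omega> f"
  obtains z where "z \<in> \<Omega>" "cmod (deriv h z) \<noteq> cmod (deriv g z)"
proof (rule ccontr)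
  assume "\<not> thesis"
  with that have J0: "cmod (deriv h z) = cmod (deriv g z)" if "z \<in> \<Omega>" for z using \<open>z \<in> \<Omega>\<close> by blast
  have h: "h holomorphic_on \<Omega>" and g: "g holomorphic_on \<Omega>"
    and f: "\<And>z. z \<in> \<Omega> \<Longrightarrow> f z = h z + cnj (g z)"
    using assms(3) by (auto simp: harmonic_decomposition_def)
  note hol = holomorphic_deriv[OF _ \<open>open \<Omega>\<close>]
  obtain B c where B: "open B" "connected B" "B \<noteq> {}" "B \<subseteq> \<Omega>" "cmod c = 1"
    "\<And>z. z \<in> B \<Longrightarrow> deriv g z = c * deriv h z"
  proof (cases "\<forall>z\<in>\<Omega>. deriv h z = 0")
    case True
    obtain z0 r where "r > 0" "ball z0 r \<subseteq> \<Omega>"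
      using assms open_contains_ball by (metis ex_in_conv)
    moreover have "deriv g z = 1 * deriv h z" if "z \<in> \<Omega>" for z
      using True J0[OF that] that by auto
    ultimately show ?thesis by (intro that[of "ball z0 r" 1]) auto
  next
    case False
    let ?D = "\<Omega> \<inter> deriv h -` (- {0})"
    have "open ?D"
      by (intro continuous_open_preimage holomorphic_on_imp_continuous_on hol h \<open>open \<Omega>\<close>) auto
    moreover obtain z0 where z0: "z0 \<in> ?D" using False by auto
    ultimately obtain r where r: "r > 0" "ball z0 r \<subseteq> ?D"
      using open_contains_ball by blast
    let ?B = "ball z0 r"
    have sub: "?B \<subseteq> \<Omega>" and h': "\<And>z. z \<in> ?B \<Longrightarrow> deriv h z \<noteq> 0" using r by auto
    have "dilatation h g holomorphic_on ?B"
      using holomorphic_on_subset[OF h sub] holomorphic_on_subset[OF g sub] h'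
      by (intro dilatation_holomorphic_on) auto
    moreover have nrm: "cmod (dilatation h g z) = 1" if "z \<in> ?B" for z
      using J0[of z] h'[OF that] that sub by (auto simp: dilatation_def norm_divide)
    ultimately have "dilatation h g constant_on ?B"
      using maximum_modulus_principle[of "dilatation h g" ?B ?B z0] r by auto
    then obtain c where c: "\<And>z. z \<in> ?B \<Longrightarrow> dilatation h g z = c"
      by (auto simp: constant_on_def)
    show ?thesis
    proof (rule that[OF open_ball connected_ball _ sub])
      show "?B \<noteq> {}" "cmod c = 1" using r nrm[of z0] c[of z0] by auto
      show "deriv g z = c * deriv h z" if "z \<in> ?B" for z
        using c[OF that] h'[OF that] by (auto simp: dilatation_def)
    qed
  qed
  have hB: "h holomorphic_on B" "g holomorphic_on B" using h g B holomorphic_on_subset by blast+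
  have "deriv g z = deriv (\<lambda>z. c * h z) z" if "z \<in> B" for z
    using B(6)[OF that] deriv_cmult[OF holomorphic_on_imp_differentiable_at[OF hB(1) B(1) that]] by simp
  moreover have "(\<lambda>z. c * h z) holomorphic_on B"
    by (intro holomorphic_intros hB)
  ultimately obtain C where C: "\<And>z. z \<in> B \<Longrightarrow> g z = c * h z + C"
    using deriv_eq_imp_add_const[OF B(1,2) hB(2)] by blast
  obtain z0 where "z0 \<in> B" using B by auto
  then obtain U where U: "open U" "z0 \<in> U" "U \<subseteq> \<Omega>" "inj_on f U"
    using assms(4) B(4) by (meson locally_univalent_on_def subsetD)
  have "\<not> inj_on (\<lambda>z. 1 * h z + cnj c * cnj (h z) + cnj C) (U \<inter> B)"
    by (rule unimodular_combination_not_inj)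
       (use U B \<open>z0 \<in> B\<close> hB in \<open>auto intro: holomorphic_on_subset\<close>)
  moreover have "inj_on f (U \<inter> B)" using U(4) by (rule inj_on_subset) auto
  then have "inj_on (\<lambda>z. 1 * h z + cnj c * cnj (h z) + cnj C) (U \<inter> B)"
    by (rule inj_on_cong[THEN iffD1, rotated]) (use f C B in auto)
  ultimately show False by blast
qed

section \<open>Harmonic Moebius transformations have zero Schwarzian\<close>

lemma moebius_on_has_field_derivative:
  assumes "open \<Omega>" "moebius_on \<Omega> T"
  shows "\<exists>c d k. k \<noteq> 0 \<and>
    (\<forall>z\<in>\<Omega>. c * z + d \<noteq> 0 \<and> (T has_field_derivative k / (c * z + d)\<^sup>2) (at z))"
proof -
  obtain a b c d where det: "a * d - b * c \<noteq> 0"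
    and nz: "\<And>z. z \<in> \<Omega> \<Longrightarrow> c * z + d \<noteq> 0" and T: "\<And>z. z \<in> \<Omega> \<Longrightarrow> T z = (a * z + b) / (c * z + d)"
    using assms(2) unfolding moebius_on_def by blast
  have "(T has_field_derivative (a * d - b * c) / (c * z + d)\<^sup>2) (at z)" if "z \<in> \<Omega>" for z
  proof (rule has_field_derivative_transform_within_open[OF _ assms(1) that])
    show "((\<lambda>z. (a * z + b) / (c * z + d)) has_field_derivative (a * d - b * c) / (c * z + d)\<^sup>2) (at z)"
      using nz[OF that]
      by (auto intro!: derivative_eq_intros simp: power2_eq_square) (simp add: algebra_simps)
  qed (use T in auto)
  with det nz show ?thesis by blast
qed

text \<open>
  Constancy of the dilatation \<open>l / k\<close> removes every term except the classical Schwarzian of \<open>k T\<close>.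
  A map of the other orientation is covered by exchanging \<open>H\<close> and \<open>G\<close>.
\<close>
lemma schwarzian_sense_preserving_moebius_eq_0:
  assumes "open \<Omega>" "moebius_on \<Omega> T" "k \<noteq> 0"
    and H': "\<And>z. z \<in> \<Omega> \<Longrightarrow> deriv H z = k * deriv T z"
    and G': "\<And>z. z \<in> \<Omega> \<Longrightarrow> deriv G z = l * deriv T z"
    and "z \<in> \<Omega>"
  shows "schwarzian_sense_preserving H G z = 0"
proof -
  obtain c d m where m: "m \<noteq> 0" and nz: "\<And>z. z \<in> \<Omega> \<Longrightarrow> c * z + d \<noteq> 0"
    and T': "\<And>z. z \<in> \<Omega> \<Longrightarrow> (T has_field_derivative m / (c * z + d)\<^sup>2) (at z)"
    using moebius_on_has_field_derivative[OF assms(1,2)] by blast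
  \<comment> \<open>The derivatives involved are known on \<open>\<Omega>\<close> only, so passing to the next order needs openness.\<close>
  have ev: "deriv P w = deriv Q w" if "\<And>z. z \<in> \<Omega> \<Longrightarrow> P z = Q z" "w \<in> \<Omega>" for P Q :: "complex \<Rightarrow> complex" and w
    by (rule deriv_cong_ev) (use that assms(1) in \<open>auto simp: eventually_nhds\<close>)
  have dH: "deriv H z = k * m / (c * z + d)\<^sup>2" if "z \<in> \<Omega>" for z
    using H'[OF that] DERIV_imp_deriv[OF T'[OF that]] by simp
  have dG: "deriv G z = l * m / (c * z + d)\<^sup>2" if "z \<in> \<Omega>" for z
    using G'[OF that] DERIV_imp_deriv[OF T'[OF that]] by simp
  have ddH: "deriv (deriv H) z = - 2 * c * k * m / (c * z + d)^3" if "z \<in> \<Omega>" for z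
  proof -
    have "deriv (deriv H) z = deriv (\<lambda>z. k * m / (c * z + d)\<^sup>2) z"
      by (rule ev[OF dH that])
    also have "\<dots> = - (k * m * (2 * (c * z + d) * c)) / ((c * z + d)\<^sup>2 * (c * z + d)\<^sup>2)"
      by (rule DERIV_imp_deriv) (use nz[OF that] in \<open>auto intro!: derivative_eq_intros\<close>)
    also have "\<dots> = - 2 * c * k * m / (c * z + d)^3"
      using nz[OF that] by (simp add: divide_simps) (simp add: eval_nat_numeral)
    finally show ?thesis .
  qed
  have P: "deriv (deriv H) z / deriv H z = - 2 * c / (c * z + d)" if "z \<in> \<Omega>" for z
    using nz[OF that] m \<open>k \<noteq> 0\<close>
    by (simp add: dH[OF that] ddH[OF that] divide_simps) (simp add: eval_nat_numeral)
  have "deriv (\<lambda>z. deriv (deriv H) z / deriv H z) z = deriv (\<lambda>z. - 2 * c / (c * z + d)) z"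
    by (rule ev[OF P \<open>z \<in> \<Omega>\<close>])
  also have "\<dots> = 2 * c\<^sup>2 / (c * z + d)\<^sup>2"
    by (rule DERIV_imp_deriv)
       (use nz[OF \<open>z \<in> \<Omega>\<close>] in \<open>auto intro!: derivative_eq_intros simp: power2_eq_square\<close>)
  finally have "classical_schwarzian H z = 0"
    using nz[OF \<open>z \<in> \<Omega>\<close>] by (simp add: classical_schwarzian_def P[OF \<open>z \<in> \<Omega>\<close>] power_divide power_mult_distrib)
  moreover have "dilatation H G w = l / k" if "w \<in> \<Omega>" for w
    using nz[OF that] m \<open>k \<noteq> 0\<close> by (simp add: dilatation_def dH[OF that] dG[OF that])
  then have "deriv (dilatation H G) w = 0" if "w \<in> \<Omega>" for w
    using ev[of "dilatation H G" "\<lambda>_. l / k" w] that by simp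
  moreover from this have "deriv (deriv (dilatation H G)) z = 0"
    using ev[of "deriv (dilatation H G)" "\<lambda>_. 0" z] \<open>z \<in> \<Omega>\<close> by simp
  ultimately show ?thesis
    using \<open>z \<in> \<Omega>\<close> by (simp add: schwarzian_sense_preserving_def)
qed

text \<open>
  Both sides are sums of an analytic and an antianalytic function. Such a splitting is unique up to
  constants, and derivatives do not see the constants.
\<close>
lemma harmonic_moebius_derivs:
  assumes "open \<Omega>" "h holomorphic_on \<Omega>" "g holomorphic_on \<Omega>" "T holomorphic_on \<Omega>"
    and eq: "\<And>z. z \<in> \<Omega> \<Longrightarrow> h z + cnj (g z) = \<alpha> * T z + \<beta> * cnj (T z) + \<gamma>" and "z \<in> \<Omega>"
  shows "deriv h z = \<alpha> * deriv T z" "deriv g z = cnj \<beta> * deriv T z"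
proof -
  have d: "(h has_field_derivative deriv h z) (at z)" "(g has_field_derivative deriv g z) (at z)"
     "(T has_field_derivative deriv T z) (at z)"
    using assms by (auto intro: holomorphic_derivI)
  let ?F = "\<lambda>z. h z + cnj (g z) - (\<alpha> * T z + \<beta> * cnj (T z) + \<gamma>)"
  have D: "(?F has_derivative (\<lambda>v. (deriv h z - \<alpha> * deriv T z) * v
       + cnj (deriv g z - cnj \<beta> * deriv T z) * cnj v)) (at z)"
    by (rule derivative_eq_intros d[THEN has_field_derivative_imp_has_derivative] refl)+
       (simp add: algebra_simps)
  have "?F w = 0" if "w \<in> \<Omega>" for w using eq[OF that] by simp
  note has_derivative_conj_linear_eq_0[OF assms(1) \<open>z \<in> \<Omega>\<close> this D]
  then show "deriv h z = \<alpha> * deriv T z" "deriv g z = cnj \<beta> * deriv T z"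
    by (simp_all only: complex_cnj_zero_iff right_minus_eq)
qed

section \<open>The characterization\<close>

theorem corollary2:
  fixes \<Omega> :: "complex set" and f h g :: "complex \<Rightarrow> complex"
  assumes "open \<Omega>" and "connected \<Omega>" and "\<Omega> \<noteq> {}" and "simply_connected \<Omega>"
    and "harmonic_decomposition \<Omega> f h g"
    and "locally_univalent_on \<Omega> f"
  shows "harmonic_moebius_on \<Omega> f \<longleftrightarrow> (\<forall>z\<in>\<Omega>. harmonic_schwarzian \<Omega> h g z = 0)"
proof -
  have h: "h holomorphic_on \<Omega>" and g: "g holomorphic_on \<Omega>"
    and f: "\<And>z. z \<in> \<Omega> \<Longrightarrow> f z = h z + cnj (g z)"
    using assms(5) by (auto simp: harmonic_decomposition_def)
  obtain z1 where z1: "z1 \<in> \<Omega>" using assms(3) by auto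
  show ?thesis
  proof
    assume "harmonic_moebius_on \<Omega> f"
    then obtain T \<alpha> \<beta> \<gamma> where T: "moebius_on \<Omega> T"
      and fT: "\<And>z. z \<in> \<Omega> \<Longrightarrow> f z = \<alpha> * T z + \<beta> * cnj (T z) + \<gamma>"
      unfolding harmonic_moebius_on_def by blast
    obtain c d m where m: "m \<noteq> 0" and nz: "\<And>z. z \<in> \<Omega> \<Longrightarrow> c * z + d \<noteq> 0"
      and T': "\<And>z. z \<in> \<Omega> \<Longrightarrow> (T has_field_derivative m / (c * z + d)\<^sup>2) (at z)"
      using moebius_on_has_field_derivative[OF assms(1) T] by blast
    have Thol: "T holomorphic_on \<Omega>"
      using T' assms(1) by (meson holomorphic_on_open)
    have Tnz: "deriv T z \<noteq> 0" if "z \<in> \<Omega>" for z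
      using DERIV_imp_deriv[OF T'[OF that]] m nz[OF that] by simp
    have h': "deriv h z = \<alpha> * deriv T z" and g': "deriv g z = cnj \<beta> * deriv T z" if "z \<in> \<Omega>" for z
      using harmonic_moebius_derivs[OF assms(1) h g Thol _ that, of \<alpha> \<beta> \<gamma>] f fT by auto
    obtain U where U: "open U" "z1 \<in> U" "U \<subseteq> \<Omega>" "inj_on f U"
      using assms(6) z1 by (meson locally_univalent_on_def)
    then have "inj_on (\<lambda>z. \<alpha> * T z + \<beta> * cnj (T z) + \<gamma>) U"
      by (simp add: inj_on_def fT[symmetric] subset_iff)
    then have ne: "cmod \<alpha> \<noteq> cmod \<beta>"
      using unimodular_combination_not_inj[of U T \<alpha> \<beta> \<gamma>] U holomorphic_on_subset[OF Thol U(3)] by blast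
    have J: "jacobian h g z = ((cmod \<alpha>)\<^sup>2 - (cmod \<beta>)\<^sup>2) * (cmod (deriv T z))\<^sup>2" if "z \<in> \<Omega>" for z
      by (simp add: jacobian_def h'[OF that] g'[OF that] norm_mult power_mult_distrib algebra_simps)
    show "\<forall>z\<in>\<Omega>. harmonic_schwarzian \<Omega> h g z = 0"
    proof (cases "sense_preserving_on \<Omega> h g")
      case True
      then have "\<alpha> \<noteq> 0" using J z1 by (force simp: sense_preserving_on_def h' jacobian_def)
      then show ?thesis
        using schwarzian_sense_preserving_moebius_eq_0[OF assms(1) T _ h' g'] True
        by (simp add: harmonic_schwarzian_def)
    next
      case False
      have "\<beta> \<noteq> 0"
      proof
        assume "\<beta> = 0"
        then have "\<alpha> \<noteq> 0" using ne by auto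
        then have "sense_preserving_on \<Omega> h g"
          using J Tnz \<open>\<beta> = 0\<close> by (auto simp: sense_preserving_on_def)
        with False show False ..
      qed
      then show ?thesis
        using schwarzian_sense_preserving_moebius_eq_0[OF assms(1) T _ g' h'] False
        by (simp add: harmonic_schwarzian_def)
    qed
  next
    assume S0: "\<forall>z\<in>\<Omega>. harmonic_schwarzian \<Omega> h g z = 0"
    show "harmonic_moebius_on \<Omega> f"
    proof (cases "sense_preserving_on \<Omega> h g")
      case True
      then have "cmod (deriv h z1) > cmod (deriv g z1)"
        using z1 by (auto simp: sense_preserving_on_def jacobian_def intro: power2_less_imp_less)
      then have "deriv h z1 \<noteq> 0" "cmod (deriv h z1) \<noteq> cmod (deriv g z1)" by auto
      moreover have "schwarzian_sense_preserving h g z = 0" if "z \<in> \<Omega>" for z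
        using S0 True that by (simp add: harmonic_schwarzian_def)
      ultimately obtain c C where M: "moebius_on \<Omega> h" and C: "\<And>z. z \<in> \<Omega> \<Longrightarrow> g z = c * h z + C"
        using schwarzian_zero_imp_moebius[OF assms(1,2) h g z1] by blast
      have "f z = 1 * h z + cnj c * cnj (h z) + cnj C" if "z \<in> \<Omega>" for z
        using f[OF that] C[OF that] by simp
      with M assms(6) show ?thesis unfolding harmonic_moebius_on_def by blast
    next
      case False
      \<comment> \<open>The Jacobian is nonzero on a nonempty open set, so the absence of a suitable point means
        \<open>g' = 0\<close> on \<open>\<Omega>\<close>. Then \<open>f\<close> is analytic, hence conformal by local univalence, and thus
        sense-preserving.\<close>
      obtain z2 where z2: "z2 \<in> \<Omega>" "deriv g z2 \<noteq> 0" "cmod (deriv g z2) \<noteq> cmod (deriv h z2)"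
      proof (rule ccontr)
        assume "\<not> thesis"
        with that have no: "deriv g z = 0"
          if "z \<in> \<Omega>" "cmod (deriv g z) \<noteq> cmod (deriv h z)" for z using \<open>z \<in> \<Omega>\<close> \<open>cmod (deriv g z) \<noteq> _\<close> by blast
        note hol = holomorphic_deriv[OF _ \<open>open \<Omega>\<close>]
        let ?D = "\<Omega> \<inter> (\<lambda>z. cmod (deriv g z) - cmod (deriv h z)) -` (- {0})"
        have "continuous_on \<Omega> (deriv h)" "continuous_on \<Omega> (deriv g)"
          using hol[OF h] hol[OF g] by (auto intro: holomorphic_on_imp_continuous_on)
        then have "open ?D"
          using \<open>open \<Omega>\<close> by (intro continuous_open_preimage continuous_on_diff continuous_on_norm) auto
        moreover obtain z where "z \<in> ?D"
          using locally_univalent_imp_ex_jacobian_nonzero[OF assms(1,3,5,6)] by force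
        ultimately have D: "open ?D" "?D \<noteq> {}" "?D \<subseteq> \<Omega>" by blast+
        have gD: "deriv g w = 0" if "w \<in> ?D" for w
          using no[of w] that by simp
        have g0: "deriv g w = 0" if "w \<in> \<Omega>" for w
          by (rule analytic_continuation_open[OF D(1) assms(1) D(2) assms(2) D(3) hol[OF g] _ gD that])
             (rule holomorphic_on_const)
        then obtain C where C: "\<And>z. z \<in> \<Omega> \<Longrightarrow> g z = C"
          using deriv_eq_imp_add_const[OF assms(1,2) g, of "\<lambda>_. 0"] by auto
        obtain z where z: "z \<in> \<Omega>" "deriv h z = 0"
          using False g0 by (auto simp: sense_preserving_on_def jacobian_def)
        obtain U where U: "open U" "z \<in> U" "U \<subseteq> \<Omega>" "inj_on f U"
          using assms(6) z by (meson locally_univalent_on_def)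
        have "inj_on h U"
          using U(3,4) f C unfolding inj_on_def by (metis subsetD)
        then have "deriv h z \<noteq> 0"
          using holomorphic_injective_imp_regular[of h U z] holomorphic_on_subset[OF h U(3)] U by blast
        with z show False by simp
      qed
      have "schwarzian_sense_preserving g h z = 0" if "z \<in> \<Omega>" for z
        using S0 False that by (simp add: harmonic_schwarzian_def)
      then obtain c C where M: "moebius_on \<Omega> g" and C: "\<And>z. z \<in> \<Omega> \<Longrightarrow> h z = c * g z + C"
        using schwarzian_zero_imp_moebius[OF assms(1,2) g h z2] by blast
      have "f z = c * g z + 1 * cnj (g z) + C" if "z \<in> \<Omega>" for z
        using f[OF that] C[OF that] by simp
      with M assms(6) show ?thesis unfolding harmonic_moebius_on_def by blast
    qed
  qed
qed

end
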